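(* Let $P^*$ be the kernel of any discrete-time birth-and-death chain on $\{0, \dots, d\}$, with birth probabilities $p^*_i$ and death probabilities $q^*_i$. (a) If $P^*$ has (strictly) positive eigenvalues, then $p^*_{i-1}+q^*_i<1$ for $1\le i\le d$. (b) If $P^*$ has nonnegative eigenvalues, then $P^*$ is monotone.
   Context: A birth-and-death kernel on $\{0,\dots,d\}$ with death, hold, birth probabilities $q^*_i,r^*_i,p^*_i$ is the tridiagonal stochastic matrix with $P^*(i,i-1)=q^*_i$, $P^*(i,i)=r^*_i$, $P^*(i,i+1)=p^*_i$, $q^*_0=0$, $p^*_d=0$. "Has positive (nonnegative) eigenvalues" means that all eigenvalues are positive (nonnegative). A kernel $P^*$ is monotone if $\sum_{k>j}P^*(i,k)$ is nondecreasing in $i$ for each $j$; for a birth-and-death kernel this is equivalent to $p^*_{i-1}+q^*_i\le1$ for $1\le i\le d$. *)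

theory Defs
  imports Complex_Main "Jordan_Normal_Form.Char_Poly"
begin

text \<open>Death, hold and birth probabilities on the state space \<open>{0..d}\<close>; values of the
  functions outside this range are irrelevant.\<close>

definition birth_death_probs ::
  "nat \<Rightarrow> (nat \<Rightarrow> real) \<Rightarrow> (nat \<Rightarrow> real) \<Rightarrow> (nat \<Rightarrow> real) \<Rightarrow> bool" where
  "birth_death_probs d q r p \<longleftrightarrow>
     (\<forall>i\<le>d. 0 \<le> q i \<and> 0 \<le> r i \<and> 0 \<le> p i \<and> q i + r i + p i = 1) \<and> q 0 = 0 \<and> p d = 0"

definition birth_death_kernel ::
  "nat \<Rightarrow> (nat \<Rightarrow> real) \<Rightarrow> (nat \<Rightarrow> real) \<Rightarrow> (nat \<Rightarrow> real) \<Rightarrow> real mat" where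
  "birth_death_kernel d q r p = mat (Suc d) (Suc d)
     (\<lambda>(i, j). if i = Suc j then q i else if j = i then r i else if j = Suc i then p i else 0)"

text \<open>``All eigenvalues'' refers to all complex eigenvalues, so both properties include that
  the spectrum is real.\<close>

definition has_positive_eigenvalues :: "real mat \<Rightarrow> bool" where
  "has_positive_eigenvalues P \<longleftrightarrow>
     (\<forall>z. eigenvalue (map_mat complex_of_real P) z \<longrightarrow> z \<in> \<real> \<and> 0 < Re z)"

definition has_nonnegative_eigenvalues :: "real mat \<Rightarrow> bool" where
  "has_nonnegative_eigenvalues P \<longleftrightarrow>
     (\<forall>z. eigenvalue (map_mat complex_of_real P) z \<longrightarrow> z \<in> \<real> \<and> 0 \<le> Re z)"

definition monotone_kernel :: "real mat \<Rightarrow> bool" where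
  "monotone_kernel P \<longleftrightarrow>
     (\<forall>j<dim_col P. mono_on {..<dim_row P} (\<lambda>i. \<Sum>k\<in>{j<..<dim_col P}. P $$ (i, k)))"

end

theory Submission
  imports Defs "HOL-Analysis.Elementary_Metric_Spaces"
begin

text \<open>Let \<open>D\<^sub>k(t)\<close> be the leading principal minors of \<open>P + t I\<close>; they satisfy
  \<open>D\<^sub>k\<^sub>+\<^sub>2 = (r\<^sub>k\<^sub>+\<^sub>1 + t) D\<^sub>k\<^sub>+\<^sub>1 - p\<^sub>k q\<^sub>k\<^sub>+\<^sub>1 D\<^sub>k\<close>. If the full determinant has no zero \<open>t \<ge> s\<close>, then all
  the \<open>D\<^sub>k\<close> are positive on \<open>{s..}\<close>: otherwise, at the largest \<open>t\<close> where one of them is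
  nonpositive, all are nonnegative, and for the largest \<open>k\<close> with \<open>D\<^sub>k(t) = 0\<close> the recurrence gives
  \<open>D\<^sub>k\<^sub>+\<^sub>1(t) \<le> 0\<close>, a contradiction. Positivity forces \<open>p\<^sub>k q\<^sub>k\<^sub>+\<^sub>1 < (r\<^sub>k + t) (r\<^sub>k\<^sub>+\<^sub>1 + t)\<close>. At
  \<open>t = 0\<close>, respectively as \<open>t\<close> tends to \<open>0\<close>, combine this with \<open>r\<^sub>k \<le> 1 - p\<^sub>k\<close> and
  \<open>r\<^sub>k\<^sub>+\<^sub>1 \<le> 1 - q\<^sub>k\<^sub>+\<^sub>1\<close>.\<close>

definition tridiagonal_mat ::
  "nat \<Rightarrow> (nat \<Rightarrow> 'a) \<Rightarrow> (nat \<Rightarrow> 'a) \<Rightarrow> (nat \<Rightarrow> 'a) \<Rightarrow> 'a :: zero mat" where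
  "tridiagonal_mat n q a p = mat n n
     (\<lambda>(i, j). if i = Suc j then q i else if j = i then a i else if j = Suc i then p i else 0)"

fun continuant :: "(nat \<Rightarrow> 'a) \<Rightarrow> (nat \<Rightarrow> 'a) \<Rightarrow> nat \<Rightarrow> 'a :: comm_ring_1" where
  "continuant a b 0 = 1"
| "continuant a b (Suc 0) = a 0"
| "continuant a b (Suc (Suc n)) = a (Suc n) * continuant a b (Suc n) - b n * continuant a b n"

lemma tridiagonal_mat_carrier [simp]: "tridiagonal_mat n q a p \<in> carrier_mat n n"
  by (simp add: tridiagonal_mat_def)

lemma det_tridiagonal_mat_Suc_Suc:
  fixes q a p :: "nat \<Rightarrow> 'a :: comm_ring_1"
  shows "det (tridiagonal_mat (Suc (Suc n)) q a p) =
    a (Suc n) * det (tridiagonal_mat (Suc n) q a p)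
      - p n * q (Suc n) * det (tridiagonal_mat n q a p)"
proof -
  let ?T = "\<lambda>n. tridiagonal_mat n q a p"
  let ?A = "?T (Suc (Suc n))"
  define M where "M = mat_delete ?A (Suc n) n"
  have M: "M \<in> carrier_mat (Suc n) (Suc n)"
    by (simp add: M_def mat_delete_def tridiagonal_mat_def)
  have del: "mat_delete ?A (Suc n) (Suc n) = ?T (Suc n)"
    by (rule eq_matI) (auto simp: mat_delete_def tridiagonal_mat_def)
  have delM: "mat_delete M n n = ?T n"
    by (rule eq_matI) (auto simp: M_def mat_delete_def tridiagonal_mat_def)
  have col: "M $$ (i, n) = (if i = n then p n else 0)" if "i < Suc n" for i
    using that by (auto simp: M_def mat_delete_def tridiagonal_mat_def)
  have "det M = (\<Sum>i<Suc n. M $$ (i, n) * cofactor M i n)"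
    by (rule laplace_expansion_column[OF M]) simp
  also have "\<dots> = (\<Sum>i<Suc n. if i = n then p n * cofactor M n n else 0)"
    by (rule sum.cong) (auto simp: col)
  also have "\<dots> = p n * det (?T n)"
    by (simp add: cofactor_def delM)
  finally have detM: "det M = p n * det (?T n)" .
  have row: "?A $$ (Suc n, j) = (if j = Suc n then a (Suc n) else if j = n then q (Suc n) else 0)"
    if "j < Suc (Suc n)" for j
    using that by (auto simp: tridiagonal_mat_def)
  have "det ?A = (\<Sum>j<Suc (Suc n). ?A $$ (Suc n, j) * cofactor ?A (Suc n) j)"
    by (rule laplace_expansion_row[OF tridiagonal_mat_carrier]) simp
  also have "\<dots> = a (Suc n) * cofactor ?A (Suc n) (Suc n) + q (Suc n) * cofactor ?A (Suc n) n"
    by (simp add: row)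
  also have "\<dots> = a (Suc n) * det (?T (Suc n)) - p n * q (Suc n) * det (?T n)"
    by (simp add: cofactor_def del detM flip: M_def)
  finally show ?thesis .
qed

lemma det_tridiagonal_mat:
  "det (tridiagonal_mat n q a p) = continuant a (\<lambda>i. p i * q (Suc i)) n"
proof (induction a "\<lambda>i. p i * q (Suc i)" n rule: continuant.induct)
  case (1 a)
  show ?case by (simp add: tridiagonal_mat_def)
next
  case (2 a)
  show ?case by (simp add: tridiagonal_mat_def det_single)
next
  case (3 a n)
  then show ?case by (simp add: det_tridiagonal_mat_Suc_Suc)
qed

lemma continuous_on_continuant:
  fixes a b :: "nat \<Rightarrow> real"
  shows "continuous_on A (\<lambda>t. continuant (\<lambda>i. a i + t) b n)"
proof (induction a b n rule: continuant.induct)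
  case (3 a b n)
  then show ?case by (simp only: continuant.simps) (intro continuous_intros)
qed (auto intro!: continuous_intros)

lemma eventually_continuant_pos:
  fixes a b :: "nat \<Rightarrow> real"
  shows "\<forall>\<^sub>F t in at_top. 0 < continuant (\<lambda>i. a i + t) b n"
proof -
  define D where "D = (\<lambda>n t. continuant (\<lambda>i. a i + t) b n)"
  have "\<forall>\<^sub>F t in at_top. 0 < D n t \<and> D n t \<le> D (Suc n) t"
  proof (induction n)
    case 0
    show ?case
      using eventually_ge_at_top[of "1 - a 0"] by eventually_elim (simp add: D_def)
  next
    case (Suc n)
    show ?case
      using Suc eventually_ge_at_top[of "1 + \<bar>b n\<bar> - a (Suc n)"]
    proof eventually_elim
      case (elim t)
      have "b n * D n t \<le> \<bar>b n\<bar> * D (Suc n) t"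
        using elim by (intro mult_mono) auto
      moreover have "(1 + \<bar>b n\<bar>) * D (Suc n) t \<le> (a (Suc n) + t) * D (Suc n) t"
        using elim by (intro mult_right_mono) auto
      ultimately show ?case
        using elim by (simp add: D_def algebra_simps)
    qed
  qed
  then show ?thesis by eventually_elim (simp add: D_def)
qed

lemma continuant_pos:
  fixes a b :: "nat \<Rightarrow> real"
  assumes b: "\<And>i. Suc i < n \<Longrightarrow> 0 \<le> b i"
    and nz: "\<And>t. s \<le> t \<Longrightarrow> continuant (\<lambda>i. a i + t) b n \<noteq> 0"
    and "s \<le> t" "k \<le> n"
  shows "0 < continuant (\<lambda>i. a i + t) b k"
proof (rule ccontr)
  define D where "D = (\<lambda>k t. continuant (\<lambda>i. a i + t) b k)"
  define S where "S = (\<Union>k\<in>{..n}. {s..} \<inter> {t. D k t \<le> 0})"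
  assume "\<not> ?thesis"
  with assms have ne: "S \<noteq> {}" by (auto simp: S_def D_def not_less)
  have closed: "closed S"
    unfolding S_def D_def
    by (intro closed_UN closed_Int closed_Collect_le ballI finite_atMost
        continuous_on_continuant continuous_on_const closed_atLeast)
  have "\<forall>\<^sub>F t in at_top. \<forall>k\<in>{..n}. 0 < D k t"
    unfolding D_def by (intro eventually_ball_finite finite_atMost ballI eventually_continuant_pos)
  then obtain B where B: "\<And>t k. B \<le> t \<Longrightarrow> k \<le> n \<Longrightarrow> 0 < D k t"
    by (auto simp: eventually_at_top_linorder)
  have bdd: "bdd_above S"
    by (rule bdd_aboveI[of _ B]) (use B in \<open>fastforce simp: S_def simp flip: not_less\<close>)
  define u where "u = Sup S"
  have "u \<in> S"
    unfolding u_def using ne bdd closed by (rule closed_contains_Sup)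
  then have "s \<le> u" and ex: "\<exists>k\<le>n. D k u \<le> 0"
    by (auto simp: S_def)
  have ge: "0 \<le> D k u" if "k \<le> n" for k
  proof (rule tendsto_lowerbound)
    have "isCont (D k) u"
      using continuous_on_continuant[of UNIV a b k]
      by (simp add: D_def continuous_on_eq_continuous_at)
    then show "(D k \<longlongrightarrow> D k u) (at_right u)"
      by (auto simp: isCont_def filterlim_at_split)
    have "0 \<le> D k t" if "u < t" for t
    proof (rule ccontr)
      assume "\<not> 0 \<le> D k t"
      with \<open>k \<le> n\<close> \<open>s \<le> u\<close> \<open>u < t\<close> have "t \<in> S"
        by (auto simp: S_def intro!: bexI[of _ k])
      then have "t \<le> u" unfolding u_def using bdd by (rule cSup_upper)
      with \<open>u < t\<close> show False by simp
    qed
    then show "\<forall>\<^sub>F t in at_right u. 0 \<le> D k t"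
      by (simp add: eventually_at_right_less eventually_mono[OF eventually_at_right_less])
  qed simp
  define m where "m = (GREATEST k. k \<le> n \<and> D k u \<le> 0)"
  have m: "m \<le> n \<and> D m u \<le> 0"
    unfolding m_def using ex by (rule GreatestI_ex_nat[where b = n]) auto
  have m_max: "k \<le> m" if "k \<le> n" "D k u \<le> 0" for k
    unfolding m_def by (rule Greatest_le_nat[where b = n]) (use that in auto)
  from m ge[of m] have "D m u = 0" by simp
  moreover from nz \<open>s \<le> u\<close> have "D n u \<noteq> 0" by (simp add: D_def)
  ultimately have "m < n" using m by (cases "m = n") auto
  obtain l where l: "m = Suc l"
    using \<open>D m u = 0\<close> by (cases m) (auto simp: D_def)
  have "D (Suc m) u = - b l * D l u"
    using \<open>D m u = 0\<close> by (simp add: D_def l)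
  also have "\<dots> \<le> 0"
    using b[of l] ge[of l] \<open>m < n\<close> by (simp add: l)
  finally have "Suc m \<le> m" using \<open>m < n\<close> by (intro m_max) auto
  then show False by simp
qed

lemma continuant_pos_imp_less:
  fixes a b :: "nat \<Rightarrow> real"
  assumes pos: "\<And>i. i \<le> Suc (Suc k) \<Longrightarrow> 0 < continuant a b i"
    and b: "\<And>i. i < k \<Longrightarrow> 0 \<le> b i" and "0 \<le> a (Suc k)"
  shows "b k < a k * a (Suc k)"
proof -
  let ?D = "continuant a b"
  have "?D (Suc k) \<le> a k * ?D k"
  proof (cases k)
    case (Suc l)
    then show ?thesis using pos[of l] b[of l] by simp
  qed simp
  then have "a (Suc k) * ?D (Suc k) \<le> a (Suc k) * (a k * ?D k)"
    using \<open>0 \<le> a (Suc k)\<close> by (rule mult_left_mono)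
  with pos[of "Suc (Suc k)"] have "b k * ?D k < (a k * a (Suc k)) * ?D k"
    by (simp add: mult_ac)
  with pos[of k] show ?thesis by simp
qed

lemma eigenvalue_birth_death_kernel_minus_of_real_iff:
  "eigenvalue (map_mat complex_of_real (birth_death_kernel d q r p)) (- complex_of_real t) \<longleftrightarrow>
     continuant (\<lambda>i. r i + t) (\<lambda>i. p i * q (Suc i)) (Suc d) = 0"
proof -
  let ?A = "map_mat complex_of_real (birth_death_kernel d q r p)"
  let ?T = "tridiagonal_mat (Suc d) q (\<lambda>i. r i + t) p"
  have A: "?A \<in> carrier_mat (Suc d) (Suc d)"
    by (simp add: birth_death_kernel_def)
  have "char_matrix ?A (- complex_of_real t) = map_mat complex_of_real ?T"
    by (rule eq_matI) (auto simp: char_matrix_def birth_death_kernel_def tridiagonal_mat_def)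
  then show ?thesis
    by (simp add: eigenvalue_det[OF A] of_real_hom.hom_det det_tridiagonal_mat)
qed

lemma birth_death_kernel_offdiagonal_less:
  assumes bd: "birth_death_probs d q r p"
    and noneig: "\<And>t. s \<le> t \<Longrightarrow>
      \<not> eigenvalue (map_mat complex_of_real (birth_death_kernel d q r p)) (- complex_of_real t)"
    and "0 \<le> s" "k < d"
  shows "p k * q (Suc k) < (r k + s) * (r (Suc k) + s)"
proof -
  have b: "0 \<le> p i * q (Suc i)" if "Suc i < Suc d" for i
    using bd that by (auto simp: birth_death_probs_def)
  have "0 \<le> r (Suc k) + s"
    using bd \<open>0 \<le> s\<close> \<open>k < d\<close> by (auto simp: birth_death_probs_def)
  moreover have "0 < continuant (\<lambda>i. r i + s) (\<lambda>i. p i * q (Suc i)) i" if "i \<le> Suc d" for i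
    using that noneig
    by (intro continuant_pos[where n = "Suc d" and s = s] b)
      (auto simp: eigenvalue_birth_death_kernel_minus_of_real_iff)
  ultimately show ?thesis
    using \<open>k < d\<close> by (intro continuant_pos_imp_less[where a = "\<lambda>i. r i + s"] b) auto
qed

lemma birth_death_kernel_tail_sum:
  assumes "birth_death_probs d q r p" "i \<le> d"
  shows "(\<Sum>k\<in>{j<..<Suc d}. birth_death_kernel d q r p $$ (i, k)) =
    (if Suc j < i then 1 else if i = Suc j then 1 - q i else if i = j then p i else 0)"
proof -
  have *: "birth_death_kernel d q r p $$ (i, k) =
      (if k = i - 1 then q i else 0) + (if k = i then r i else 0) + (if k = Suc i then p i else 0)"
    if "k \<in> {j<..<Suc d}" for k
    using that assms by (auto simp: birth_death_kernel_def birth_death_probs_def)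
  have "i = d \<longrightarrow> p i = 0" "q i + r i + p i = 1"
    using assms by (auto simp: birth_death_probs_def)
  with \<open>i \<le> d\<close> show ?thesis
    by (subst sum.cong[OF refl *]; cases "i = Suc j") (auto simp: sum.distrib)
qed

lemma birth_death_kernel_monotoneI:
  assumes bd: "birth_death_probs d q r p" and le: "\<And>k. k < d \<Longrightarrow> p k + q (Suc k) \<le> 1"
  shows "monotone_kernel (birth_death_kernel d q r p)"
proof -
  have "(\<Sum>k\<in>{j<..<Suc d}. birth_death_kernel d q r p $$ (i, k)) \<le>
        (\<Sum>k\<in>{j<..<Suc d}. birth_death_kernel d q r p $$ (i', k))"
    if "i \<le> i'" "i' \<le> d" for i i' j
  proof -
    have "i \<le> d" using that by simp
    have bounds: "0 \<le> p k" "p k \<le> 1" "0 \<le> q k" "q k \<le> 1" if "k \<le> d" for k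
      using bd that by (auto simp: birth_death_probs_def)
    show ?thesis
      using that bounds[OF \<open>i \<le> d\<close>] bounds[OF \<open>i' \<le> d\<close>] le[of i]
      by (auto simp: birth_death_kernel_tail_sum[OF bd \<open>i \<le> d\<close>]
          birth_death_kernel_tail_sum[OF bd \<open>i' \<le> d\<close>])
  qed
  then show ?thesis
    by (auto simp: monotone_kernel_def birth_death_kernel_def mono_on_def)
qed

theorem lemma2p4:
  fixes d :: nat and q r p :: "nat \<Rightarrow> real"
  assumes "birth_death_probs d q r p"
  shows "(has_positive_eigenvalues (birth_death_kernel d q r p) \<longrightarrow>
           (\<forall>i\<in>{1..d}. p (i - 1) + q i < 1)) \<and>
         (has_nonnegative_eigenvalues (birth_death_kernel d q r p) \<longrightarrow>
           monotone_kernel (birth_death_kernel d q r p))"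
proof (intro conjI impI ballI)
  have rr: "r k * r (Suc k) \<le> (1 - p k) * (1 - q (Suc k))" if "k < d" for k
  proof (rule mult_mono)
    have k: "k \<le> d" "Suc k \<le> d" using that by auto
    from assms k show "r k \<le> 1 - p k" "r (Suc k) \<le> 1 - q (Suc k)" "0 \<le> 1 - p k" "0 \<le> r (Suc k)"
      unfolding birth_death_probs_def by (smt (verit))+
  qed
  {
    fix i assume pos: "has_positive_eigenvalues (birth_death_kernel d q r p)" and "i \<in> {1..d}"
    then obtain k where k: "i = Suc k" "k < d" by (cases i) auto
    have "p k * q (Suc k) < (r k + 0) * (r (Suc k) + 0)"
    proof (rule birth_death_kernel_offdiagonal_less[OF assms])
      fix t :: real assume "0 \<le> t"
      with pos show "\<not> eigenvalue (map_mat complex_of_real (birth_death_kernel d q r p))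
          (- complex_of_real t)"
        by (auto simp: has_positive_eigenvalues_def dest!: spec[of _ "- complex_of_real t"])
    qed (use \<open>k < d\<close> in auto)
    with rr[OF \<open>k < d\<close>] show "p (i - 1) + q i < 1"
      by (simp add: k algebra_simps)
  next
    assume nonneg: "has_nonnegative_eigenvalues (birth_death_kernel d q r p)"
    have "p k + q (Suc k) \<le> 1" if "k < d" for k
    proof -
      have "p k * q (Suc k) < (r k + s) * (r (Suc k) + s)" if "0 < s" for s
      proof (rule birth_death_kernel_offdiagonal_less[OF assms])
        fix t assume "s \<le> t"
        with nonneg \<open>0 < s\<close> show "\<not> eigenvalue (map_mat complex_of_real (birth_death_kernel d q r p))
            (- complex_of_real t)"
          by (auto simp: has_nonnegative_eigenvalues_def dest!: spec[of _ "- complex_of_real t"])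
      qed (use \<open>k < d\<close> \<open>0 < s\<close> in auto)
      then have "\<forall>\<^sub>F s in at_right 0. p k * q (Suc k) \<le> (r k + s) * (r (Suc k) + s)"
        by (intro eventually_mono[OF eventually_at_right_less]) (auto intro: less_imp_le)
      moreover have "((\<lambda>s. (r k + s) * (r (Suc k) + s)) \<longlongrightarrow> (r k + 0) * (r (Suc k) + 0)) (at_right 0)"
        by (intro tendsto_intros)
      ultimately have "p k * q (Suc k) \<le> (r k + 0) * (r (Suc k) + 0)"
        by (intro tendsto_lowerbound) auto
      with rr[OF that] show ?thesis
        by (simp add: algebra_simps)
    qed
    then show "monotone_kernel (birth_death_kernel d q r p)"
      by (intro birth_death_kernel_monotoneI assms)
  }
qed

end
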